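(* Let $X,Y$ be finite nonempty sets. For every (total or partial) Boolean function $f:X\times Y\rightarrow\{0,1\}$, $$Q(f)=\left\lceil \frac{\log_2(k_f+1)}{2}\right\rceil ,$$ where $Q(f)$ is the unbounded-error one-way quantum communication complexity of $f$ and $k_f$ is the smallest dimension of an arrangement of points and hyperplanes realizing $f$.
   Context: A partial Boolean function $f:X\times Y\to\{0,1\}$ is defined only on a subset $\mathrm{dom}(f)\subseteq X\times Y$; it is total if $\mathrm{dom}(f)=X\times Y$. One-way quantum protocol with cost $n$ (an integer $n\ge 0$) for $f$ (Alice holds $x$, Bob holds $y$, no shared randomness or entanglement): for each $x\in X$ an $n$-qubit state $\rho_x$ (a $2^n\times 2^n$ positive semidefinite complex matrix of trace $1$), sent by Alice to Bob, and for each $y\in Y$ a two-outcome POVM $\{E_y,I-E_y\}$ on $n$ qubits ($E_y$ and $I-E_y$ positive semidefinite). Bob outputs $0$ with probability $\mathrm{Tr}(E_y\rho_x)$ and $1$ otherwise. The protocol computes $f$ (unbounded-error) if for every $(x,y)\in\mathrm{dom}(f)$ Bob outputs $f(x,y)$ with probability strictly larger than $1/2$. $Q(f)$ is the minimum cost $n$ of such a protocol computing $f$. Arrangements: for an integer $k\ge 0$, a point is a vector $\mathbf p=(p_1,\dots,p_k)\in\mathbb R^k$, and a hyperplane in $\mathbb{R}^k$ is encoded by a real vector $\mathbf h=(h_1,\dots,h_k,h_{k+1})\in\mathbb R^{k+1}$ (representing $\{a\in\mathbb R^k: \sum_{i=1}^k a_ih_i=h_{k+1}\}$; any real vector is allowed).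 Put $\delta(\mathbf p,\mathbf h)=\mathrm{sign}\left(\sum_{i=1}^k p_ih_i-h_{k+1}\right)$ with $\mathrm{sign}(a)=1,-1,0$ for $a>0$, $a<0$, $a=0$. A $k$-dimensional arrangement of points $(\mathbf p_x)_{x\in X}$ in $\mathbb R^k$ and hyperplanes $(\mathbf h_y)_{y\in Y}$ in $\mathbb R^{k+1}$ realizes $f$ if $\delta(\mathbf p_x,\mathbf h_y)=(-1)^{f(x,y)}$ for all $(x,y)\in\mathrm{dom}(f)$. $k_f$ is the smallest $k$ for which such an arrangement exists. *)

theory Defs
  imports Complex_Main "Jordan_Normal_Form.Schur_Decomposition"
begin

text \<open>
  A partial Boolean function on \<open>X \<times> Y\<close> is a map \<open>f :: 'a \<times> 'b \<rightharpoonup> bool\<close> with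
  \<open>dom f \<subseteq> X \<times> Y\<close>; the truth values \<open>False\<close> and \<open>True\<close> stand for 0 and 1.
\<close>

section \<open>One-way quantum protocols\<close>

definition mat_trace :: "'a::comm_monoid_add mat \<Rightarrow> 'a" where
  "mat_trace A = (\<Sum>i<dim_row A. A $$ (i, i))"

text \<open>
  The form \<open>(A *\<^sub>v v) \<bullet>c v\<close> is \<open>v\<^sup>* A v\<close>. The order on \<open>complex\<close> is that of
  \<open>Complex_Order\<close>: \<open>0 \<le> z\<close> means that \<open>z\<close> is real and nonnegative.
\<close>

definition psd :: "nat \<Rightarrow> complex mat \<Rightarrow> bool" where
  "psd d A \<longleftrightarrow> A \<in> carrier_mat d d \<and> mat_adjoint A = A \<and>
     (\<forall>v \<in> carrier_vec d. 0 \<le> (A *\<^sub>v v) \<bullet>c v)"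

definition qubit_state :: "nat \<Rightarrow> complex mat \<Rightarrow> bool" where
  "qubit_state n \<rho> \<longleftrightarrow> psd (2 ^ n) \<rho> \<and> mat_trace \<rho> = 1"

text \<open>The two-outcome POVM \<open>{E, I - E}\<close> is represented by its first element \<open>E\<close>.\<close>

definition qubit_povm :: "nat \<Rightarrow> complex mat \<Rightarrow> bool" where
  "qubit_povm n E \<longleftrightarrow> psd (2 ^ n) E \<and> psd (2 ^ n) (1\<^sub>m (2 ^ n) - E)"

text \<open>
  For a state \<open>\<rho>\<close> and a POVM element \<open>E\<close> the trace of \<open>E * \<rho>\<close> is a real number, so taking
  the real part loses nothing.
\<close>

definition output_prob :: "complex mat \<Rightarrow> complex mat \<Rightarrow> bool \<Rightarrow> real" where
  "output_prob E \<rho> b =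
     (if b then 1 - Re (mat_trace (E * \<rho>)) else Re (mat_trace (E * \<rho>)))"

definition quantum_protocol ::
  "nat \<Rightarrow> 'a set \<Rightarrow> 'b set \<Rightarrow> ('a \<Rightarrow> complex mat) \<Rightarrow> ('b \<Rightarrow> complex mat) \<Rightarrow> bool" where
  "quantum_protocol n X Y \<rho> E \<longleftrightarrow>
     (\<forall>x\<in>X. qubit_state n (\<rho> x)) \<and> (\<forall>y\<in>Y. qubit_povm n (E y))"

definition protocol_computes ::
  "('a \<Rightarrow> complex mat) \<Rightarrow> ('b \<Rightarrow> complex mat) \<Rightarrow> ('a \<times> 'b \<rightharpoonup> bool) \<Rightarrow> bool" where
  "protocol_computes \<rho> E f \<longleftrightarrow>
     (\<forall>(x, y) \<in> dom f. output_prob (E y) (\<rho> x) (the (f (x, y))) > 1 / 2)"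

definition Q_cost :: "'a set \<Rightarrow> 'b set \<Rightarrow> ('a \<times> 'b \<rightharpoonup> bool) \<Rightarrow> nat" where
  "Q_cost X Y f =
     (LEAST n. \<exists>\<rho> E. quantum_protocol n X Y \<rho> E \<and> protocol_computes \<rho> E f)"

section \<open>Arrangements of points and hyperplanes\<close>

text \<open>
  Vectors are indexed from 0, so the offset \<open>h\<^sub>k\<^sub>+\<^sub>1\<close> of a hyperplane
  \<open>h \<in> carrier_vec (k + 1)\<close> is \<open>h $ k\<close>.
\<close>

definition \<delta> :: "nat \<Rightarrow> real vec \<Rightarrow> real vec \<Rightarrow> real" where
  "\<delta> k p h = sgn ((\<Sum>i<k. p $ i * h $ i) - h $ k)"

definition arrangement ::
  "nat \<Rightarrow> 'a set \<Rightarrow> 'b set \<Rightarrow> ('a \<Rightarrow> real vec) \<Rightarrow> ('b \<Rightarrow> real vec) \<Rightarrow> bool" where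
  "arrangement k X Y p h \<longleftrightarrow>
     (\<forall>x\<in>X. p x \<in> carrier_vec k) \<and> (\<forall>y\<in>Y. h y \<in> carrier_vec (k + 1))"

definition realizes ::
  "nat \<Rightarrow> ('a \<Rightarrow> real vec) \<Rightarrow> ('b \<Rightarrow> real vec) \<Rightarrow> ('a \<times> 'b \<rightharpoonup> bool) \<Rightarrow> bool" where
  "realizes k p h f \<longleftrightarrow>
     (\<forall>(x, y) \<in> dom f. \<delta> k (p x) (h y) = (- 1) ^ of_bool (the (f (x, y))))"

definition arrangement_dim :: "'a set \<Rightarrow> 'b set \<Rightarrow> ('a \<times> 'b \<rightharpoonup> bool) \<Rightarrow> nat" where
  "arrangement_dim X Y f =
     (LEAST k. \<exists>p h. arrangement k X Y p h \<and> realizes k p h f)"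

end

theory Submission
  imports Defs
begin

text \<open>
  Sending a Hermitian matrix \<open>A\<close> of size \<open>d\<close> to the real numbers \<open>Re A\<^sub>i\<^sub>j + Im A\<^sub>i\<^sub>j\<close> is a linear
  isometry from the Hermitian matrices with the trace form onto the space of real
  \<open>d \<times> d\<close> arrays. The normalization of the trace fixes one diagonal entry of a state, so the
  states span an affine space of dimension \<open>d\<^sup>2 - 1\<close>, and a protocol is an arrangement in it.
  Conversely, a suitably scaled arrangement of that dimension yields
  perturbations of the maximally mixed state and of the POVM element \<open>I / 2\<close>, which remain positive.
  So a protocol of cost \<open>n\<close> exists iff \<open>k\<^sub>f + 1 \<le> 4 ^ n\<close>.
\<close>

section \<open>Real coordinates of Hermitian matrices\<close>

definition hermitian :: "nat \<Rightarrow> complex mat \<Rightarrow> bool" where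
  "hermitian d A \<longleftrightarrow> A \<in> carrier_mat d d \<and> (\<forall>i<d. \<forall>j<d. A $$ (j, i) = cnj (A $$ (i, j)))"

text \<open>For Hermitian \<open>A\<close> the positions (i, j) and (j, i) hold Re + Im and Re - Im
  of one complex entry, so the array determines \<open>A\<close> without separating the diagonal
  from the two triangles.\<close>

definition hcoord :: "complex mat \<Rightarrow> nat \<Rightarrow> nat \<Rightarrow> real" where
  "hcoord A i j = Re (A $$ (i, j)) + Im (A $$ (i, j))"

text \<open>The inverse of \<open>hcoord\<close>: half-sum and half-difference of mirrored positions
  recover the real and imaginary parts.\<close>

definition hmat :: "nat \<Rightarrow> (nat \<Rightarrow> nat \<Rightarrow> real) \<Rightarrow> complex mat" where
  "hmat d c = mat d d (\<lambda>(i, j). Complex ((c i j + c j i) / 2) ((c i j - c j i) / 2))"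

lemma hermitianD:
  assumes "hermitian d A" "i < d" "j < d"
  shows "Re (A $$ (j, i)) = Re (A $$ (i, j))" "Im (A $$ (j, i)) = - Im (A $$ (i, j))"
proof -
  have "A $$ (j, i) = cnj (A $$ (i, j))"
    using assms unfolding hermitian_def by blast
  then show "Re (A $$ (j, i)) = Re (A $$ (i, j))" "Im (A $$ (j, i)) = - Im (A $$ (i, j))"
    by simp_all
qed

lemma hermitian_iff_adjoint:
  "hermitian d A \<longleftrightarrow> A \<in> carrier_mat d d \<and> mat_adjoint A = A"
proof -
  have "mat_adjoint A = A \<longleftrightarrow> (\<forall>i<d. \<forall>j<d. A $$ (j, i) = cnj (A $$ (i, j)))"
    if A: "A \<in> carrier_mat d d"
  proof -
    have ent: "mat_adjoint A $$ (i, j) = cnj (A $$ (j, i))" if "i < d" "j < d" for i j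
      using A that by (simp add: mat_adjoint_def mat_of_rows_def)
    have dim: "dim_row (mat_adjoint A) = d" "dim_col (mat_adjoint A) = d"
      using A by (auto simp: mat_adjoint_def)
    show ?thesis
    proof
      assume adj: "mat_adjoint A = A"
      show "\<forall>i<d. \<forall>j<d. A $$ (j, i) = cnj (A $$ (i, j))"
        using ent unfolding adj by blast
    next
      assume herm: "\<forall>i<d. \<forall>j<d. A $$ (j, i) = cnj (A $$ (i, j))"
      show "mat_adjoint A = A"
      proof (rule eq_matI)
        fix i j assume "i < dim_row A" "j < dim_col A"
        then have "i < d" "j < d"
          using A by auto
        then show "mat_adjoint A $$ (i, j) = A $$ (i, j)"
          using herm ent by metis
      qed (use A dim in auto)
    qed
  qed
  then show ?thesis
    unfolding hermitian_def by blast
qed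

lemma hmat_carrier [simp]: "hmat d c \<in> carrier_mat d d"
  and hmat_dim [simp]: "dim_row (hmat d c) = d" "dim_col (hmat d c) = d"
  by (auto simp: hmat_def)

lemma hermitian_hmat [simp]: "hermitian d (hmat d c)"
  by (auto simp: hermitian_def hmat_def complex_eq_iff field_simps)

lemma hcoord_hmat [simp]: "i < d \<Longrightarrow> j < d \<Longrightarrow> hcoord (hmat d c) i j = c i j"
  by (simp add: hcoord_def hmat_def field_simps)

text \<open>The product of coordinates splits into \<open>rr\<close>, which is the real part of the
  summand of the trace, and mixed terms \<open>cross\<close>. The latter are antisymmetric in i and
  j, since Im changes sign under transposition and Re does not, so they sum to zero.\<close>

lemma trace_mult_hermitian:
  assumes A: "hermitian d A" and B: "hermitian d B"
  shows "Re (mat_trace (A * B)) = (\<Sum>i<d. \<Sum>j<d. hcoord A i j * hcoord B i j)"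
proof -
  have car: "A \<in> carrier_mat d d" "B \<in> carrier_mat d d"
    using assms by (auto simp: hermitian_def)
  define rr where "rr = (\<lambda>i j. Re (A $$ (i, j)) * Re (B $$ (i, j)) + Im (A $$ (i, j)) * Im (B $$ (i, j)))"
  define cross where "cross = (\<lambda>i j. Re (A $$ (i, j)) * Im (B $$ (i, j)) + Im (A $$ (i, j)) * Re (B $$ (i, j)))"
  have "Re (mat_trace (A * B)) = (\<Sum>i<d. \<Sum>j<d. Re (A $$ (i, j) * B $$ (j, i)))"
    using car by (simp add: mat_trace_def scalar_prod_def lessThan_atLeast0)
  also have "\<dots> = (\<Sum>i<d. \<Sum>j<d. rr i j)"
  proof (intro sum.cong refl)
    fix i j assume "i \<in> {..<d}" "j \<in> {..<d}"
    then show "Re (A $$ (i, j) * B $$ (j, i)) = rr i j"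
      using hermitianD[OF B, of i j] by (simp add: rr_def)
  qed
  finally have tr: "Re (mat_trace (A * B)) = (\<Sum>i<d. \<Sum>j<d. rr i j)" .
  have "(\<Sum>i<d. \<Sum>j<d. cross i j) = (\<Sum>j<d. \<Sum>i<d. cross i j)"
    by (rule sum.swap)
  also have "\<dots> = (\<Sum>j<d. \<Sum>i<d. - cross j i)"
  proof (intro sum.cong refl)
    fix i j assume "j \<in> {..<d}" "i \<in> {..<d}"
    then show "cross i j = - cross j i"
      using hermitianD[OF A, of j i] hermitianD[OF B, of j i] by (simp add: cross_def)
  qed
  also have "\<dots> = - (\<Sum>i<d. \<Sum>j<d. cross i j)"
    by (simp only: sum_negf)
  finally have "(\<Sum>i<d. \<Sum>j<d. cross i j) = 0"
    by (simp only: equal_neg_zero)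
  moreover have "(\<Sum>i<d. \<Sum>j<d. hcoord A i j * hcoord B i j)
      = (\<Sum>i<d. \<Sum>j<d. rr i j) + (\<Sum>i<d. \<Sum>j<d. cross i j)"
    unfolding sum.distrib[symmetric]
    by (intro sum.cong refl) (simp add: hcoord_def rr_def cross_def algebra_simps)
  ultimately show ?thesis
    using tr by simp
qed

lemma trace_hermitian:
  assumes A: "hermitian d A"
  shows "mat_trace A = of_real (\<Sum>i<d. hcoord A i i)"
proof -
  have "A $$ (i, i) = of_real (hcoord A i i)" if "i < d" for i
    using hermitianD(2)[OF A that that] by (simp add: hcoord_def complex_eq_iff)
  moreover have "dim_row A = d"
    using A by (auto simp: hermitian_def)
  ultimately show ?thesis
    by (simp add: mat_trace_def)
qed

lemma psd_hermitian: "psd d A \<Longrightarrow> hermitian d A"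
  by (simp add: psd_def hermitian_iff_adjoint)

lemma sum_of_bool_eq:
  fixes F :: "nat \<Rightarrow> nat \<Rightarrow> 'a::comm_semiring_1"
  shows "(\<Sum>i<d. \<Sum>j<d. of_bool (i = j) * F i j) = (\<Sum>i<d. F i i)"
proof (rule sum.cong[OF refl])
  fix i assume i: "i \<in> {..<d}"
  have "(\<Sum>j<d. of_bool (i = j) * F i j) = (\<Sum>j<d. if i = j then F i j else 0)"
    by (intro sum.cong refl) auto
  then show "(\<Sum>j<d. of_bool (i = j) * F i j) = F i i"
    using i by simp
qed

section \<open>Positivity of perturbed multiples of the identity\<close>

lemma hermitian_form:
  assumes "A \<in> carrier_mat d d" "v \<in> carrier_vec d"
  shows "(A *\<^sub>v v) \<bullet>c v = (\<Sum>i<d. \<Sum>j<d. A $$ (i, j) * v $ j * cnj (v $ i))"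
  using assms by (simp add: scalar_prod_def lessThan_atLeast0 sum_distrib_right)

lemma hermitian_form_real:
  assumes A: "hermitian d A" and v: "v \<in> carrier_vec d"
  shows "Im ((A *\<^sub>v v) \<bullet>c v) = 0"
proof -
  have car: "A \<in> carrier_mat d d"
    using A by (simp add: hermitian_def)
  let ?S = "\<Sum>i<d. \<Sum>j<d. A $$ (i, j) * v $ j * cnj (v $ i)"
  \<comment> \<open>By Hermitian symmetry, conjugation merely exchanges i and j, so the form equals
    its own conjugate.\<close>
  have "cnj ?S = (\<Sum>i<d. \<Sum>j<d. A $$ (j, i) * v $ i * cnj (v $ j))"
    unfolding cnj_sum
  proof (intro sum.cong refl)
    fix i j assume "i \<in> {..<d}" "j \<in> {..<d}"
    then have "A $$ (j, i) = cnj (A $$ (i, j))"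
      using A unfolding hermitian_def by blast
    then show "cnj (A $$ (i, j) * v $ j * cnj (v $ i)) = A $$ (j, i) * v $ i * cnj (v $ j)"
      by simp
  qed
  also have "\<dots> = ?S"
    by (rule sum.swap)
  finally have "?S \<in> \<real>"
    by (simp only: Reals_cnj_iff)
  then show ?thesis
    unfolding hermitian_form[OF car v] by (simp only: complex_is_Real_iff)
qed

text \<open>Each product of two entry norms is at most the squared norm of \<open>v\<close>. This
  crude substitute for the operator norm suffices because only some positive threshold for
  perturbations is wanted.\<close>

lemma norm_form_le:
  fixes d :: nat
  shows "norm (\<Sum>i<d. \<Sum>j<d. a i j * v j * cnj (v i))
    \<le> (\<Sum>i<d. \<Sum>j<d. norm (a i j)) * (\<Sum>i<d. (norm (v i))\<^sup>2)"
proof -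
  let ?s = "\<Sum>i<d. (norm (v i))\<^sup>2"
  have le: "norm (v j) * norm (v i) \<le> ?s" if "i < d" "j < d" for i j
  proof -
    have "(norm (v i))\<^sup>2 \<le> ?s" "(norm (v j))\<^sup>2 \<le> ?s"
      using that by (auto intro!: member_le_sum)
    moreover have "2 * (norm (v j) * norm (v i)) \<le> (norm (v i))\<^sup>2 + (norm (v j))\<^sup>2"
      using sum_squares_bound[of "norm (v j)" "norm (v i)"] by (simp add: algebra_simps)
    ultimately show ?thesis
      by linarith
  qed
  have "norm (\<Sum>i<d. \<Sum>j<d. a i j * v j * cnj (v i))
      \<le> (\<Sum>i<d. \<Sum>j<d. norm (a i j * v j * cnj (v i)))"
    by (intro order.trans[OF norm_sum] sum_mono norm_sum)
  also have "\<dots> \<le> (\<Sum>i<d. \<Sum>j<d. norm (a i j) * ?s)"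
    using le by (intro sum_mono) (simp add: norm_mult mult.assoc mult_left_mono)
  also have "\<dots> = (\<Sum>i<d. \<Sum>j<d. norm (a i j)) * ?s"
    by (simp only: sum_distrib_right)
  finally show ?thesis .
qed

text \<open>The identity part contributes a |v|^2 to the form and the perturbation at most |b| M
  |v|^2 in absolute value, where M is the entrywise norm sum of \<open>hmat d c\<close>.\<close>

lemma psd_perturbed_identity:
  fixes a :: real
  assumes "a > 0"
  shows "\<exists>e>0. \<forall>b. \<bar>b\<bar> \<le> e \<longrightarrow> psd d (hmat d (\<lambda>i j. a * of_bool (i = j) + b * c i j))"
proof -
  define M where "M = (\<Sum>i<d. \<Sum>j<d. norm (hmat d c $$ (i, j)))"
  have M: "M \<ge> 0"
    unfolding M_def by (intro sum_nonneg) simp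
  \<comment> \<open>The threshold is a / (M + 1) rather than a / M because M may be zero.\<close>
  have "psd d (hmat d (\<lambda>i j. a * of_bool (i = j) + b * c i j))"
    if b: "\<bar>b\<bar> \<le> a / (M + 1)" for b
  proof -
    let ?A = "hmat d (\<lambda>i j. a * of_bool (i = j) + b * c i j)"
    have ent: "?A $$ (i, j) = of_real a * of_bool (i = j) + of_real b * hmat d c $$ (i, j)"
      if "i < d" "j < d" for i j
      using that by (auto simp: hmat_def complex_eq_iff field_simps)
    have "0 \<le> (?A *\<^sub>v v) \<bullet>c v" if v: "v \<in> carrier_vec d" for v
    proof -
      let ?s = "\<Sum>i<d. (norm (v $ i))\<^sup>2"
      let ?F = "\<Sum>i<d. \<Sum>j<d. hmat d c $$ (i, j) * v $ j * cnj (v $ i)"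
      have "(?A *\<^sub>v v) \<bullet>c v = (\<Sum>i<d. \<Sum>j<d. ?A $$ (i, j) * v $ j * cnj (v $ i))"
        by (rule hermitian_form[OF hmat_carrier v])
      also have "\<dots> = (\<Sum>i<d. \<Sum>j<d. of_real a * (of_bool (i = j) * (v $ j * cnj (v $ i)))
          + of_real b * (hmat d c $$ (i, j) * v $ j * cnj (v $ i)))"
      proof (intro sum.cong refl)
        fix i j assume "i \<in> {..<d}" "j \<in> {..<d}"
        then show "?A $$ (i, j) * v $ j * cnj (v $ i)
            = of_real a * (of_bool (i = j) * (v $ j * cnj (v $ i)))
              + of_real b * (hmat d c $$ (i, j) * v $ j * cnj (v $ i))"
          using ent[of i j] by (simp only: lessThan_iff distrib_right mult.assoc)
      qed
      also have "\<dots> = of_real a * (\<Sum>i<d. \<Sum>j<d. of_bool (i = j) * (v $ j * cnj (v $ i)))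
          + of_real b * ?F"
        by (simp only: sum.distrib sum_distrib_left)
      also have "(\<Sum>i<d. \<Sum>j<d. of_bool (i = j) * (v $ j * cnj (v $ i))) = of_real ?s"
        by (simp only: sum_of_bool_eq of_real_sum complex_norm_square)
      finally have form: "(?A *\<^sub>v v) \<bullet>c v = of_real (a * ?s) + of_real b * ?F"
        by (simp only: of_real_mult)
      have s: "?s \<ge> 0"
        by (intro sum_nonneg) simp
      have "\<bar>Re (of_real b * ?F)\<bar> \<le> \<bar>b\<bar> * norm ?F"
        using abs_Re_le_cmod[of "of_real b * ?F"] by (simp add: norm_mult)
      also have "\<dots> \<le> \<bar>b\<bar> * (M * ?s)"
        unfolding M_def by (intro mult_left_mono norm_form_le) simp
      also have "\<dots> = (\<bar>b\<bar> * M) * ?s"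
        by simp
      also have "\<dots> \<le> a * ?s"
      proof (intro mult_right_mono s)
        have "\<bar>b\<bar> * (M + 1) \<le> a"
          using b M by (simp add: field_simps)
        then show "\<bar>b\<bar> * M \<le> a"
          by (simp add: distrib_left)
      qed
      finally have "0 \<le> a * ?s + Re (of_real b * ?F)"
        by linarith
      then have "0 \<le> Re ((?A *\<^sub>v v) \<bullet>c v)"
        unfolding form by (simp only: plus_complex.sel Re_complex_of_real)
      moreover have "Im ((?A *\<^sub>v v) \<bullet>c v) = 0"
        using v by (intro hermitian_form_real) auto
      ultimately show ?thesis
        by (simp add: less_eq_complex_def)
    qed
    then show ?thesis
      using hermitian_hmat[of d] unfolding psd_def hermitian_iff_adjoint by blast
  qed
  moreover have "a / (M + 1) > 0"
    using assms M by simp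
  ultimately show ?thesis
    by blast
qed

text \<open>Complementing a POVM element near I / 2 only flips the sign of the perturbation, so
  positivity for both signs of \<open>b\<close> yields a POVM.\<close>

lemma one_minus_hmat:
  "1\<^sub>m d - hmat d (\<lambda>i j. (1 / 2) * of_bool (i = j) + b * c i j)
    = hmat d (\<lambda>i j. (1 / 2) * of_bool (i = j) + (- b) * c i j)"
  by (rule eq_matI) (auto simp: hmat_def complex_eq_iff field_simps)

section \<open>Protocols and arrangements\<close>

lemma sum_div_mod:
  "(\<Sum>m<d * d. g (m div d) (m mod d)) = (\<Sum>i<d. \<Sum>j<(d::nat). g i j)"
proof -
  have "(\<Sum>i<d. \<Sum>j<d. g i j) = (\<Sum>(i, j)\<in>{..<d} \<times> {..<d}. g i j)"
    by (simp add: sum.cartesian_product)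
  also have "\<dots> = (\<Sum>m<d * d. g (m div d) (m mod d))"
  proof (rule sum.reindex_bij_witness[of _ "\<lambda>m. (m div d, m mod d)" "\<lambda>(i, j). i * d + j"])
    fix ij assume "ij \<in> {..<d} \<times> {..<d}"
    then obtain i j where ij: "ij = (i, j)" "i < d" "j < d"
      by auto
    then have "i * d + j < Suc i * d"
      by simp
    also have "\<dots> \<le> d * d"
      using ij by (intro mult_le_mono1) simp
    finally show "(case ij of (i, j) \<Rightarrow> i * d + j) \<in> {..<d * d}"
      using ij by simp
  next
    fix m assume "m \<in> {..<d * d}"
    moreover from this have "d > 0"
      by (cases d) auto
    ultimately show "(m div d, m mod d) \<in> {..<d} \<times> {..<d}"
      by (simp add: less_mult_imp_div_less)
  qed auto
  finally show ?thesis
    by simp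
qed

lemma sum_div_mod_diag:
  fixes d :: nat and g :: "nat \<Rightarrow> real"
  shows "(\<Sum>m<d * d. of_bool (m div d = m mod d) * g m) = (\<Sum>i<d. g (i * d + i))"
proof -
  have "(\<Sum>m<d * d. of_bool (m div d = m mod d) * g m)
      = (\<Sum>m<d * d. (\<lambda>i j. of_bool (i = j) * g (i * d + j)) (m div d) (m mod d))"
    by (simp only: div_mult_mod_eq)
  also have "\<dots> = (\<Sum>i<d. \<Sum>j<d. of_bool (i = j) * g (i * d + j))"
    by (rule sum_div_mod)
  also have "\<dots> = (\<Sum>i<d. g (i * d + i))"
    by (rule sum_of_bool_eq)
  finally show ?thesis .
qed

text \<open>The last flattened index is the corner (d - 1, d - 1), which lies on the diagonal. This
  is the coordinate that the trace condition eliminates.\<close>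

lemma last_div_mod:
  assumes "d * d = Suc k"
  shows "k div d = k mod d"
proof (cases d)
  case (Suc e)
  then have "k = e + e * Suc e"
    using assms by simp
  then show ?thesis
    unfolding Suc by (simp del: mult_Suc_right)
qed (use assms in simp)

section \<open>From protocols to arrangements\<close>

lemma arrangement_of_states:
  assumes d: "d * d = Suc k"
  shows "\<exists>p h. (\<forall>\<rho>. p \<rho> \<in> carrier_vec k) \<and> (\<forall>E. h E \<in> carrier_vec (k + 1)) \<and>
    (\<forall>E \<rho>. hermitian d E \<longrightarrow> hermitian d \<rho> \<longrightarrow> mat_trace \<rho> = 1 \<longrightarrow>
      \<delta> k (p \<rho>) (h E) = sgn (Re (mat_trace (E * \<rho>)) - 1 / 2))"
proof -
  define cc where "cc A m = hcoord A (m div d) (m mod d)" for A m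
  define p where "p \<rho> = vec k (cc \<rho>)" for \<rho>
  \<comment> \<open>Trace 1 gives \<open>cc \<rho> k\<close> as 1 minus the other diagonal
    coordinates. Substituting this into the trace form subtracts \<open>cc E k\<close> from the
    diagonal coefficients and leaves the constant \<open>cc E k\<close>, which joins the threshold
    1/2 in the offset.\<close>
  define h where "h E = vec (k + 1) (\<lambda>m. if m < k
    then cc E m - of_bool (m div d = m mod d) * cc E k else 1 / 2 - cc E k)" for E
  have "(\<Sum>i<k. p \<rho> $ i * h E $ i) - h E $ k = Re (mat_trace (E * \<rho>)) - 1 / 2"
    if E: "hermitian d E" and R: "hermitian d \<rho>" and tr: "mat_trace \<rho> = 1" for E \<rho>
  proof -
    have "(\<Sum>m<d * d. of_bool (m div d = m mod d) * cc \<rho> m) = (\<Sum>i<d. cc \<rho> (i * d + i))"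
      by (rule sum_div_mod_diag)
    also have "\<dots> = (\<Sum>i<d. hcoord \<rho> i i)"
      by (intro sum.cong refl) (simp add: cc_def)
    also have "complex_of_real \<dots> = 1"
      using trace_hermitian[OF R] tr by simp
    finally have diag: "(\<Sum>m<d * d. of_bool (m div d = m mod d) * cc \<rho> m) = 1"
      by (simp only: of_real_eq_1_iff)
    have diag': "(\<Sum>m<k. of_bool (m div d = m mod d) * cc \<rho> m) = 1 - cc \<rho> k"
      using diag last_div_mod[OF d] unfolding d sum.lessThan_Suc by simp
    have "(\<Sum>i<k. p \<rho> $ i * h E $ i)
        = (\<Sum>m<k. cc E m * cc \<rho> m - cc E k * (of_bool (m div d = m mod d) * cc \<rho> m))"
      by (intro sum.cong refl) (simp add: p_def h_def algebra_simps)
    also have "\<dots> = (\<Sum>m<k. cc E m * cc \<rho> m) - cc E k * (1 - cc \<rho> k)"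
      by (simp only: sum_subtractf sum_distrib_left[symmetric] diag')
    also have "\<dots> = (\<Sum>m<d * d. cc E m * cc \<rho> m) - cc E k"
      by (simp add: d algebra_simps)
    also have "(\<Sum>m<d * d. cc E m * cc \<rho> m) = Re (mat_trace (E * \<rho>))"
      unfolding cc_def trace_mult_hermitian[OF E R] by (rule sum_div_mod)
    finally show ?thesis
      by (simp add: h_def)
  qed
  then have "\<forall>E \<rho>. hermitian d E \<longrightarrow> hermitian d \<rho> \<longrightarrow> mat_trace \<rho> = 1 \<longrightarrow>
      \<delta> k (p \<rho>) (h E) = sgn (Re (mat_trace (E * \<rho>)) - 1 / 2)"
    by (simp add: \<delta>_def)
  moreover have "\<forall>\<rho>. p \<rho> \<in> carrier_vec k" "\<forall>E. h E \<in> carrier_vec (k + 1)"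
    by (auto simp: p_def h_def)
  ultimately show ?thesis
    by blast
qed

lemma protocol_imp_arrangement:
  assumes d: "2 ^ n * 2 ^ n = Suc k" and dom: "dom f \<subseteq> X \<times> Y"
    and prot: "quantum_protocol n X Y \<rho> E" "protocol_computes \<rho> E f"
  shows "\<exists>p h. arrangement k X Y p h \<and> realizes k p h f"
proof -
  obtain p h where
    car: "\<forall>\<rho>. p \<rho> \<in> carrier_vec k" "\<forall>E. h E \<in> carrier_vec (k + 1)" and
    \<delta>: "\<And>E \<rho>. \<lbrakk>hermitian (2 ^ n) E; hermitian (2 ^ n) \<rho>; mat_trace \<rho> = 1\<rbrakk> \<Longrightarrow>
      \<delta> k (p \<rho>) (h E) = sgn (Re (mat_trace (E * \<rho>)) - 1 / 2)"
    using arrangement_of_states[OF d] by metis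
  have "\<delta> k (p (\<rho> x)) (h (E y)) = (- 1) ^ of_bool (the (f (x, y)))" if "(x, y) \<in> dom f" for x y
  proof -
    have "x \<in> X" "y \<in> Y"
      using that dom by auto
    then have "\<delta> k (p (\<rho> x)) (h (E y)) = sgn (Re (mat_trace (E y * \<rho> x)) - 1 / 2)"
      using prot(1)
      by (intro \<delta>) (auto simp: quantum_protocol_def qubit_state_def qubit_povm_def intro: psd_hermitian)
    moreover have "output_prob (E y) (\<rho> x) (the (f (x, y))) > 1 / 2"
      using prot(2) that unfolding protocol_computes_def by blast
    ultimately show ?thesis
      by (cases "the (f (x, y))") (auto simp: output_prob_def)
  qed
  then have "realizes k (\<lambda>x. p (\<rho> x)) (\<lambda>y. h (E y)) f"
    unfolding realizes_def by blast
  moreover have "arrangement k X Y (\<lambda>x. p (\<rho> x)) (\<lambda>y. h (E y))"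
    using car unfolding arrangement_def by blast
  ultimately show ?thesis
    by blast
qed

section \<open>From arrangements to protocols\<close>

lemma arrangement_imp_protocol:
  assumes d: "2 ^ n * 2 ^ n = Suc k" and dom: "dom f \<subseteq> X \<times> Y" and fin: "finite X"
    and arr: "realizes k p h f"
  shows "\<exists>\<rho> E. quantum_protocol n X Y \<rho> E \<and> protocol_computes \<rho> E f"
proof -
  define D :: nat where "D = 2 ^ n"
  have dD: "D * D = Suc k" and D0: "D > 0"
    using d by (auto simp: D_def)
  have kdiag: "k div D = k mod D"
    using dD by (rule last_div_mod)
  \<comment> \<open>The last coordinate is chosen to make the perturbation of the state
    traceless.\<close>
  define g where "g x m = (if m < k then p x $ m
    else - (\<Sum>m<k. of_bool (m div D = m mod D) * p x $ m))" for x m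
  \<comment> \<open>The zero at the last coordinate cancels the entry forced upon \<open>g\<close>,
    so that the pairing of \<open>H\<close> and \<open>g\<close> is the inner product of point and
    normal vector.\<close>
  define H where "H y m = (if m < k then h y $ m else 0)" for y m
  have g_diag: "(\<Sum>i<D. g x (i * D + i)) = 0" for x
    unfolding sum_div_mod_diag[symmetric] dD by (simp add: kdiag g_def)
  have Hg: "(\<Sum>i<D. \<Sum>j<D. H y (i * D + j) * g x (i * D + j)) = (\<Sum>m<k. p x $ m * h y $ m)" for x y
  proof -
    have "(\<Sum>i<D. \<Sum>j<D. H y (i * D + j) * g x (i * D + j)) = (\<Sum>m<D * D. H y m * g x m)"
      using sum_div_mod[of "\<lambda>i j. H y (i * D + j) * g x (i * D + j)" D] by simp
    also have "\<dots> = (\<Sum>m<k. p x $ m * h y $ m)"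
      unfolding dD by (simp add: H_def g_def mult.commute)
    finally show ?thesis .
  qed
  define R where "R e x = hmat D (\<lambda>i j. (1 / D) * of_bool (i = j) + e * g x (i * D + j))" for e x
  \<comment> \<open>One scale must serve all points, since it enters the POVM through
    \<open>t\<close>; finiteness of \<open>X\<close> provides it as a minimum. The scale
    \<open>b\<close> below may vary with \<open>y\<close>.\<close>
  have "\<exists>e>0. \<forall>x\<in>X. psd D (R e x)"
  proof -
    have "\<exists>e>0. \<forall>b. \<bar>b\<bar> \<le> e \<longrightarrow> psd D (R b x)" for x
      unfolding R_def using D0 by (intro psd_perturbed_identity) simp
    then obtain e where e: "\<And>x. e x > 0" "\<And>x b. \<bar>b\<bar> \<le> e x \<Longrightarrow> psd D (R b x)"
      by metis
    \<comment> \<open>The inserted 1 keeps the set nonempty if \<open>X\<close> is empty.\<close>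
    let ?m = "Min (insert 1 (e ` X))"
    have "?m > 0"
      using fin e(1) by (subst Min_gr_iff) auto
    moreover have "?m \<le> e x" if "x \<in> X" for x
      using fin that by (intro Min_le) auto
    ultimately show ?thesis
      using e(2) by (intro exI[of _ ?m]) auto
  qed
  then obtain e where e: "e > 0" "\<And>x. x \<in> X \<Longrightarrow> psd D (R e x)"
    by blast
  \<comment> \<open>The multiple of the identity added to the perturbation of \<open>I / 2\<close> that turns the offset
    of the value at a state into that of the hyperplane.\<close>
  define t where "t y = - (\<Sum>i<D. H y (i * D + i)) / D - e * h y $ k" for y
  define F where "F b y = hmat D (\<lambda>i j. (1 / 2) * of_bool (i = j)
    + b * (H y (i * D + j) + t y * of_bool (i = j)))" for b y
  have "\<exists>b>0. psd D (F b y) \<and> psd D (F (- b) y)" for y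
  proof -
    have "\<exists>b>0. \<forall>c. \<bar>c\<bar> \<le> b \<longrightarrow> psd D (F c y)"
      unfolding F_def by (intro psd_perturbed_identity) simp
    then obtain b where "b > 0" "\<And>c. \<bar>c\<bar> \<le> b \<Longrightarrow> psd D (F c y)"
      by blast
    then show ?thesis
      by (intro exI[of _ b]) auto
  qed
  then obtain b where b: "\<And>y. b y > 0" "\<And>y. psd D (F (b y) y)" "\<And>y. psd D (F (- b y) y)"
    by metis
  have "1\<^sub>m D - F (b y) y = F (- b y) y" for y
    unfolding F_def by (rule one_minus_hmat)
  then have povm: "qubit_povm n (F (b y) y)" for y
    using b by (simp add: qubit_povm_def D_def)
  have trR: "mat_trace (R e x) = 1" for x
  proof -
    have "mat_trace (R e x) = of_real (\<Sum>i<D. hcoord (R e x) i i)"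
      unfolding R_def by (intro trace_hermitian) simp
    also have "(\<Sum>i<D. hcoord (R e x) i i) = (\<Sum>i<D. 1 / D) + e * (\<Sum>i<D. g x (i * D + i))"
      by (simp add: R_def sum.distrib sum_distrib_left)
    also have "\<dots> = 1"
      using D0 by (simp add: g_diag)
    finally show ?thesis
      by simp
  qed
  have tr: "Re (mat_trace (F (b y) y * R e x))
      = 1 / 2 + b y * e * ((\<Sum>m<k. p x $ m * h y $ m) - h y $ k)" for x y
  proof -
    let ?o = "\<lambda>i j. of_bool (i = j) :: real"
    have "Re (mat_trace (F (b y) y * R e x))
        = (\<Sum>i<D. \<Sum>j<D. hcoord (F (b y) y) i j * hcoord (R e x) i j)"
      unfolding F_def R_def by (intro trace_mult_hermitian) auto
    \<comment> \<open>The four products of the parts: identity with identity, identity with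
      \<open>g\<close>, \<open>H\<close> with identity, and \<open>H\<close> with \<open>g\<close>.
      The second sums to zero because \<open>g\<close> is traceless.\<close>
    also have "\<dots> = (\<Sum>i<D. \<Sum>j<D. ?o i j * ((1 / 2 + b y * t y) / D)
        + e * (1 / 2 + b y * t y) * (?o i j * g x (i * D + j))
        + b y / D * (?o i j * H y (i * D + j))
        + b y * e * (H y (i * D + j) * g x (i * D + j)))"
      by (intro sum.cong refl) (auto simp: F_def R_def field_simps)
    also have "\<dots> = (\<Sum>i<D. \<Sum>j<D. ?o i j * ((1 / 2 + b y * t y) / D))
        + e * (1 / 2 + b y * t y) * (\<Sum>i<D. \<Sum>j<D. ?o i j * g x (i * D + j))
        + b y / D * (\<Sum>i<D. \<Sum>j<D. ?o i j * H y (i * D + j))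
        + b y * e * (\<Sum>i<D. \<Sum>j<D. H y (i * D + j) * g x (i * D + j))"
      by (simp only: sum.distrib sum_distrib_left)
    also have "\<dots> = (1 / 2 + b y * t y) + b y / D * (\<Sum>i<D. H y (i * D + i))
        + b y * e * (\<Sum>m<k. p x $ m * h y $ m)"
      using D0 by (simp only: sum_of_bool_eq g_diag Hg) simp
    \<comment> \<open>The choice of \<open>t y\<close> cancels the trace of \<open>H\<close> and
      leaves exactly the offset, scaled by \<open>b y * e\<close>. As this factor is positive, the
      bias of the output has the sign of the arrangement.\<close>
    also have "\<dots> = 1 / 2 + b y * e * ((\<Sum>m<k. p x $ m * h y $ m) - h y $ k)"
      by (simp add: t_def algebra_simps)
    finally show ?thesis .
  qed
  have "quantum_protocol n X Y (R e) (\<lambda>y. F (b y) y)"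
    using e povm trR by (simp add: quantum_protocol_def qubit_state_def D_def)
  moreover have "output_prob (F (b y) y) (R e x) (the (f (x, y))) > 1 / 2"
    if "(x, y) \<in> dom f" for x y
  proof -
    let ?z = "(\<Sum>m<k. p x $ m * h y $ m) - h y $ k"
    have "sgn ?z = (- 1) ^ of_bool (the (f (x, y)))"
      using arr that unfolding realizes_def \<delta>_def by blast
    moreover have "b y * e > 0"
      using b e by simp
    ultimately show ?thesis
      by (cases "the (f (x, y))")
        (auto simp: output_prob_def tr sgn_if zero_less_mult_iff mult_less_0_iff split: if_splits)
  qed
  ultimately show ?thesis
    unfolding protocol_computes_def by blast
qed

section \<open>Dimensions that admit arrangements\<close>

lemma arrangement_mono:
  assumes "arrangement k X Y p h" "realizes k p h f" "k \<le> l"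
  shows "\<exists>p h. arrangement l X Y p h \<and> realizes l p h f"
proof -
  define p' where "p' x = vec l (\<lambda>i. if i < k then p x $ i else 0)" for x
  \<comment> \<open>The value \<open>h y $ k\<close> is needed only at index \<open>l\<close>, the
    new offset; at the indices from \<open>k\<close> to l - 1 it meets a zero coordinate of the
    point.\<close>
  define h' where "h' y = vec (l + 1) (\<lambda>i. if i < k then h y $ i else h y $ k)" for y
  have "\<delta> l (p' x) (h' y) = \<delta> k (p x) (h y)" for x y
  proof -
    have "(\<Sum>i<l. p' x $ i * h' y $ i) = (\<Sum>i<k. p' x $ i * h' y $ i)"
      using assms(3) by (intro sum.mono_neutral_right) (auto simp: p'_def)
    also have "\<dots> = (\<Sum>i<k. p x $ i * h y $ i)"
      using assms(3) by (intro sum.cong refl) (auto simp: p'_def h'_def)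
    finally show ?thesis
      using assms(3) by (simp add: \<delta>_def h'_def)
  qed
  then have "realizes l p' h' f"
    using assms(2) by (simp add: realizes_def)
  moreover have "arrangement l X Y p' h'"
    by (simp add: arrangement_def p'_def h'_def)
  ultimately show ?thesis
    by blast
qed

text \<open>The points are the standard basis vectors indexed by \<open>X\<close>, and the
  hyperplane of \<open>y\<close> passes through the origin with the column of signs of
  \<open>y\<close> as its normal vector.\<close>

lemma arrangement_exists:
  assumes fin: "finite X" and dom: "dom f \<subseteq> X \<times> Y"
  shows "\<exists>k p h. arrangement k X Y p h \<and> realizes k p h f"
proof -
  obtain idx where "bij_betw idx X {0..<card X}"
    using ex_bij_betw_finite_nat[OF fin] by blast
  then have bij: "bij_betw idx X {..<card X}"
    by (simp add: lessThan_atLeast0)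
  let ?k = "card X"
  \<comment> \<open>Outside \<open>dom f\<close> the truth value is unspecified, but the sign is
    still 1 or -1.\<close>
  define s :: "'a \<Rightarrow> 'b \<Rightarrow> real" where "s x y = (- 1) ^ of_bool (the (f (x, y)))" for x y
  define p :: "'a \<Rightarrow> real vec" where "p x = vec ?k (\<lambda>i. of_bool (i = idx x))" for x
  define h where "h y = vec (?k + 1) (\<lambda>i. if i < ?k then s (the_inv_into X idx i) y else 0)" for y
  have "\<delta> ?k (p x) (h y) = s x y" if "x \<in> X" for x y
  proof -
    have "idx x < ?k"
      using bij that by (auto simp: bij_betw_def)
    moreover have "the_inv_into X idx (idx x) = x"
      using bij that by (intro the_inv_into_f_f) (auto simp: bij_betw_def)
    moreover have "(\<Sum>i<?k. p x $ i * h y $ i) = (\<Sum>i<?k. if i = idx x then h y $ i else 0)"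
      by (intro sum.cong refl) (auto simp: p_def)
    ultimately show ?thesis
      by (simp add: \<delta>_def h_def s_def)
  qed
  then have "realizes ?k p h f"
    using dom unfolding realizes_def s_def by blast
  moreover have "arrangement ?k X Y p h"
    by (simp add: arrangement_def p_def h_def)
  ultimately show ?thesis
    by blast
qed

section \<open>The least exponent as a ceiling\<close>

lemma Least_power4:
  "int (LEAST n. Suc k \<le> 4 ^ n) = \<lceil>log 2 (real k + 1) / 2\<rceil>"
proof -
  have iff: "Suc k \<le> 4 ^ n \<longleftrightarrow> log 2 (real k + 1) / 2 \<le> real n" for n
  proof -
    have "Suc k \<le> 4 ^ n \<longleftrightarrow> real (Suc k) \<le> real (4 ^ n)"
      by (simp only: of_nat_le_iff)
    also have "\<dots> \<longleftrightarrow> real k + 1 \<le> 2 powr (2 * real n)"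
      by (simp add: powr_powr[symmetric] powr_realpow add.commute)
    also have "\<dots> \<longleftrightarrow> log 2 (real k + 1) \<le> 2 * real n"
      by (subst log_le_iff) auto
    finally show ?thesis
      by auto
  qed
  \<comment> \<open>Since k + 1 is at least 1, the ceiling is nonnegative and survives the passage
    to natural numbers.\<close>
  have "0 \<le> log 2 (real k + 1) / 2"
    by simp
  then have pos: "0 \<le> \<lceil>log 2 (real k + 1) / 2\<rceil>"
    by linarith
  have "(LEAST n. Suc k \<le> 4 ^ n) = nat \<lceil>log 2 (real k + 1) / 2\<rceil>"
    unfolding iff by (rule Least_equality) (use pos in \<open>linarith+\<close>)
  then show ?thesis
    using pos by simp
qed

theorem theorem3p1:
  fixes X :: "'a set" and Y :: "'b set" and f :: "'a \<times> 'b \<rightharpoonup> bool"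
  assumes "finite X" and "X \<noteq> {}" and "finite Y" and "Y \<noteq> {}"
    and "dom f \<subseteq> X \<times> Y"
  shows "int (Q_cost X Y f) = \<lceil>log 2 (real (arrangement_dim X Y f) + 1) / 2\<rceil>"
proof -
  let ?A = "\<lambda>k. \<exists>p h. arrangement k X Y p h \<and> realizes k p h f"
  have "\<exists>k. ?A k"
    using arrangement_exists[OF assms(1,5)] .
  then have "?A (arrangement_dim X Y f)"
    unfolding arrangement_dim_def by (rule LeastI_ex)
  \<comment> \<open>Padding makes the realizable dimensions upward closed, so they are exactly those
    from the minimum on.\<close>
  then have A_iff: "?A k \<longleftrightarrow> arrangement_dim X Y f \<le> k" for k
    using arrangement_mono[of _ X Y _ _ f k] unfolding arrangement_dim_def
    by (blast intro: Least_le)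
  have "(\<exists>\<rho> E. quantum_protocol n X Y \<rho> E \<and> protocol_computes \<rho> E f)
      \<longleftrightarrow> Suc (arrangement_dim X Y f) \<le> 4 ^ n" for n
  proof -
    \<comment> \<open>An n-qubit state has 4^n real coordinates, one of which the trace fixes. The
      subtraction is exact because 4^n is positive.\<close>
    have d: "2 ^ n * 2 ^ n = Suc (4 ^ n - 1)"
      by (simp add: power_mult_distrib[symmetric])
    have pos: "0 < (4::nat) ^ n"
      by simp
    have "(\<exists>\<rho> E. quantum_protocol n X Y \<rho> E \<and> protocol_computes \<rho> E f) \<longleftrightarrow> ?A (4 ^ n - 1)"
      using protocol_imp_arrangement[OF d assms(5)] arrangement_imp_protocol[OF d assms(5,1)]
      by blast
    also have "\<dots> \<longleftrightarrow> Suc (arrangement_dim X Y f) \<le> 4 ^ n"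
      unfolding A_iff using pos by linarith
    finally show ?thesis .
  qed
  then show ?thesis
    unfolding Q_cost_def by (simp only: Least_power4)
qed

end
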